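(* Let $M$ be a matroid with ground set $E$ and let $(A,B)$ be an exact $3$-separation of $M$. Assume there is an $A$-strand $A_0$ and a $B$-strand $B_0$ such that $\sqcap(A_0,B_0)=1$. Then $M$ has an extension $M'$ by an element $p\notin E$ in which $A_0\cup p$ and $B_0\cup p$ are circuits if and only if $M$ has no $A$-strand $A_1$ and $B$-strand $B_1$ with $A_1\neq A_0$ and $B_1\neq B_0$ such that exactly two of $\sqcap(A_0,B_1)$, $\sqcap(A_1,B_0)$ and $\sqcap(A_1,B_1)$ are equal to one. Moreover, when $M$ has an extension by $p$ in which $A_0\cup p$ and $B_0\cup p$ are circuits, this extension is unique.
   Context: For subsets $X,Y$ of the ground set of a matroid with rank function $r$, the local connectivity is $\sqcap(X,Y)=r(X)+r(Y)-r(X\cup Y)$. A partition $(A,B)$ of the ground set $E$ of $M$ is an exact $3$-separation if $|A|,|B|\ge 3$ and $r(A)+r(B)-r(M)=2$. Given an exact $3$-separation $(A,B)$, an $A$-strand is a minimal subset $A'\subseteq A$ with $\sqcap(A',B)=1$; a $B$-strand is a minimal subset $B'\subseteq B$ with $\sqcap(B',A)=1$. An extension of $M$ by $p$ is a matroid $M'$ on $E\cup p$ with $M'\backslash p=M$. *)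

theory Defs
  imports Main
begin

text \<open>
  Finite matroids, presented by a ground set and the family of independent sets. The record only
  carries the data, the axioms being the predicate \<open>matroid\<close>; those force every
  independent set into the ground set, so equality of records is equality of matroids.
\<close>

record 'a matroid_data =
  ground :: "'a set"
  indeps :: "'a set set"

definition matroid :: "'a matroid_data \<Rightarrow> bool" where
  "matroid M \<longleftrightarrow>
     finite (ground M) \<and>
     (\<forall>I \<in> indeps M. I \<subseteq> ground M) \<and>
     {} \<in> indeps M \<and>
     (\<forall>I J. J \<in> indeps M \<and> I \<subseteq> J \<longrightarrow> I \<in> indeps M) \<and>
     (\<forall>I \<in> indeps M. \<forall>J \<in> indeps M. card I < card J \<longrightarrow>
        (\<exists>x \<in> J - I. insert x I \<in> indeps M))"

definition rank_of :: "'a matroid_data \<Rightarrow> 'a set \<Rightarrow> nat" where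
  "rank_of M X = Max (card ` {I \<in> indeps M. I \<subseteq> X})"

definition circuit :: "'a matroid_data \<Rightarrow> 'a set \<Rightarrow> bool" where
  "circuit M C \<longleftrightarrow>
     C \<subseteq> ground M \<and> C \<notin> indeps M \<and> (\<forall>D. D \<subset> C \<longrightarrow> D \<in> indeps M)"

definition deletion :: "'a matroid_data \<Rightarrow> 'a set \<Rightarrow> 'a matroid_data" where
  "deletion M D =
     \<lparr>ground = ground M - D, indeps = {I \<in> indeps M. I \<subseteq> ground M - D}\<rparr>"

definition extension_by :: "'a matroid_data \<Rightarrow> 'a \<Rightarrow> 'a matroid_data \<Rightarrow> bool" where
  "extension_by M p M' \<longleftrightarrow>
     matroid M' \<and> ground M' = insert p (ground M) \<and> deletion M' {p} = M"

definition local_conn :: "'a matroid_data \<Rightarrow> 'a set \<Rightarrow> 'a set \<Rightarrow> int" where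
  "local_conn M X Y =
     int (rank_of M X) + int (rank_of M Y) - int (rank_of M (X \<union> Y))"

definition exact_3_separation :: "'a matroid_data \<Rightarrow> 'a set \<Rightarrow> 'a set \<Rightarrow> bool" where
  "exact_3_separation M A B \<longleftrightarrow>
     A \<union> B = ground M \<and> A \<inter> B = {} \<and> 3 \<le> card A \<and> 3 \<le> card B \<and>
     int (rank_of M A) + int (rank_of M B) - int (rank_of M (ground M)) = 2"

text \<open>
  For an exact 3-separation \<open>(A, B)\<close> of \<open>M\<close>, the \<open>A\<close>-strands are the sets \<open>S\<close> with
  \<open>strand M A B S\<close>, and the \<open>B\<close>-strands are the sets \<open>S\<close> with \<open>strand M B A S\<close>.
\<close>

definition strand :: "'a matroid_data \<Rightarrow> 'a set \<Rightarrow> 'a set \<Rightarrow> 'a set \<Rightarrow> bool" where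
  "strand M A B S \<longleftrightarrow>
     S \<subseteq> A \<and> local_conn M S B = 1 \<and> (\<forall>T. T \<subset> S \<longrightarrow> local_conn M T B \<noteq> 1)"

definition exactly_two :: "bool \<Rightarrow> bool \<Rightarrow> bool \<Rightarrow> bool" where
  "exactly_two P Q R \<longleftrightarrow> (P \<and> Q \<and> \<not> R) \<or> (P \<and> \<not> Q \<and> R) \<or> (\<not> P \<and> Q \<and> R)"

end

theory Submission
  imports Defs
begin

text \<open>
  The intersection of the closures of \<open>A\<close> and \<open>B\<close> behaves like a line, on which a set
  \<open>S \<subseteq> A\<close> with \<open>\<sqinter>(S, B) = 1\<close> marks a point; \<open>S\<close> and \<open>T \<subseteq> B\<close> mark the same point iff
  \<open>\<sqinter>(S, T) = 1\<close>. The new element \<open>p\<close> must be the point marked by both \<open>A\<^sub>0\<close> and \<open>B\<^sub>0\<close>. Hence \<open>p\<close>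
  is in the closure of \<open>X\<close> iff \<open>\<sqinter>(X \<inter> A, B\<^sub>0) = 1\<close>, or \<open>\<sqinter>(A\<^sub>0, X \<inter> B) = 1\<close>, or \<open>X\<close> spans the whole line,
  that is, \<open>r(X) + r(A) + r(B) - r(X \<union> A) - r(X \<union> B) = 2\<close>. This gives uniqueness. Conversely, this
  family of sets defines an extension as soon as it is a modular cut, and the condition on strands
  is what is needed for that: it says that marking the same point as \<open>A\<^sub>0\<close> and \<open>B\<^sub>0\<close> is compatible with
  marking the same point as each other.
\<close>

section \<open>Rank functions\<close>

lemma indepD:
  assumes "matroid M" "I \<in> indeps M"
  shows "I \<subseteq> ground M" "finite I"
  using assms unfolding matroid_def by (auto intro: finite_subset)

lemma indep_subset: "matroid M \<Longrightarrow> J \<in> indeps M \<Longrightarrow> I \<subseteq> J \<Longrightarrow> I \<in> indeps M"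
  unfolding matroid_def by blast

lemma finite_indeps: "matroid M \<Longrightarrow> finite {I \<in> indeps M. I \<subseteq> X}"
  by (rule finite_subset[of _ "Pow (ground M)"]) (auto simp: matroid_def)

lemma card_le_rank: "matroid M \<Longrightarrow> I \<in> indeps M \<Longrightarrow> I \<subseteq> X \<Longrightarrow> card I \<le> rank_of M X"
  unfolding rank_of_def using finite_indeps[of M X] by (intro Max_ge) auto

lemma basis_exists:
  assumes "matroid M"
  obtains I where "I \<in> indeps M" "I \<subseteq> X" "card I = rank_of M X"
proof -
  have "{} \<in> {I \<in> indeps M. I \<subseteq> X}"
    using assms by (auto simp: matroid_def)
  hence "card ` {I \<in> indeps M. I \<subseteq> X} \<noteq> {}" by blast
  hence "rank_of M X \<in> card ` {I \<in> indeps M. I \<subseteq> X}"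
    unfolding rank_of_def by (rule Max_in[OF finite_imageI[OF finite_indeps[OF assms]]])
  then obtain I where "I \<in> indeps M" "I \<subseteq> X" "rank_of M X = card I" by blast
  thus ?thesis using that[of I] by simp
qed

lemma augment:
  assumes "matroid M" "I \<in> indeps M" "J \<in> indeps M" "card I < card J"
  obtains x where "x \<in> J" "x \<notin> I" "insert x I \<in> indeps M"
proof -
  have "\<forall>I \<in> indeps M. \<forall>J \<in> indeps M. card I < card J \<longrightarrow> (\<exists>x \<in> J - I. insert x I \<in> indeps M)"
    using assms(1) unfolding matroid_def by (elim conjE)
  with assms(2-4) that show thesis by auto
qed

lemma basis_extends:
  assumes M: "matroid M" and "I \<in> indeps M" "I \<subseteq> X"
  shows "\<exists>J \<in> indeps M. I \<subseteq> J \<and> J \<subseteq> X \<and> card J = rank_of M X"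
  using assms(2,3)
proof (induction "rank_of M X - card I" arbitrary: I rule: less_induct)
  case less
  show ?case
  proof (cases "card I < rank_of M X")
    case False
    hence "card I = rank_of M X" using card_le_rank[OF M less.prems] by simp
    thus ?thesis using less.prems by blast
  next
    case True
    obtain K where K: "K \<in> indeps M" "K \<subseteq> X" "card K = rank_of M X"
      using basis_exists[OF M, where X = X] .
    have "card I < card K" using True K(3) by simp
    then obtain x where x: "x \<in> K" "x \<notin> I" "insert x I \<in> indeps M"
      using augment[OF M less.prems(1) K(1)] by metis
    have "card (insert x I) = Suc (card I)"
      using x indepD(2)[OF M less.prems(1)] by simp
    with True have "rank_of M X - card (insert x I) < rank_of M X - card I" by simp
    moreover have "insert x I \<subseteq> X" using x(1) K(2) less.prems(2) by blast
    ultimately obtain J where "J \<in> indeps M" "insert x I \<subseteq> J" "J \<subseteq> X" "card J = rank_of M X"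
      using less.hyps[of "insert x I"] x(3) by blast
    thus ?thesis by blast
  qed
qed

lemma rank_mono:
  assumes M: "matroid M" and "X \<subseteq> Y"
  shows "rank_of M X \<le> rank_of M Y"
proof -
  obtain I where "I \<in> indeps M" "I \<subseteq> X" "card I = rank_of M X"
    using basis_exists[OF M] .
  thus ?thesis using card_le_rank[OF M, of I Y] assms(2) by auto
qed

text \<open>A basis of \<open>X \<inter> Y\<close> extends to a basis of
  \<open>X \<union> Y\<close>, whose traces on \<open>X\<close> and on \<open>Y\<close> are
  independent; counting the traces gives the inequality.\<close>

lemma rank_submodular:
  assumes M: "matroid M"
  shows "rank_of M (X \<union> Y) + rank_of M (X \<inter> Y) \<le> rank_of M X + rank_of M Y"
proof -
  obtain I where I: "I \<in> indeps M" "I \<subseteq> X \<inter> Y" "card I = rank_of M (X \<inter> Y)"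
    using basis_exists[OF M] .
  obtain J where J: "J \<in> indeps M" "I \<subseteq> J" "J \<subseteq> X \<union> Y" "card J = rank_of M (X \<union> Y)"
    using basis_extends[OF M I(1), of "X \<union> Y"] I(2) by blast
  have fin: "finite J" using indepD(2)[OF M J(1)] .
  have "card (J \<inter> X) + card (J \<inter> Y) = card ((J \<inter> X) \<union> (J \<inter> Y)) + card ((J \<inter> X) \<inter> (J \<inter> Y))"
    by (rule card_Un_Int) (use fin in auto)
  moreover have "(J \<inter> X) \<union> (J \<inter> Y) = J" using J(3) by auto
  moreover have "card I \<le> card ((J \<inter> X) \<inter> (J \<inter> Y))"
    by (rule card_mono) (use I(2) J(2) fin in blast)+
  moreover have "card (J \<inter> X) \<le> rank_of M X" "card (J \<inter> Y) \<le> rank_of M Y"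
    by (rule card_le_rank[OF M indep_subset[OF M J(1)]]; blast)+
  ultimately show ?thesis using I(3) J(4) by simp
qed

text \<open>The working form of submodularity: integers allow differences of ranks, and inclusions
  for \<open>Z\<close> and \<open>W\<close> avoid computing the union and the intersection
  exactly.\<close>

lemma rank_submodular_int:
  assumes "matroid M" "Z \<subseteq> X \<inter> Y" "W \<subseteq> X \<union> Y"
  shows "int (rank_of M W) + int (rank_of M Z) \<le> int (rank_of M X) + int (rank_of M Y)"
  using rank_submodular[OF assms(1), of X Y] rank_mono[OF assms(1,2)] rank_mono[OF assms(1,3)]
  by linarith

lemma rank_indep:
  assumes M: "matroid M" and I: "I \<in> indeps M"
  shows "rank_of M I = card I"
proof (rule antisym)
  obtain J where "J \<subseteq> I" "card J = rank_of M I"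
    using basis_exists[OF M] .
  thus "rank_of M I \<le> card I" using card_mono[OF indepD(2)[OF assms]] by metis
qed (rule card_le_rank[OF assms order_refl])

lemma rank_empty: "matroid M \<Longrightarrow> rank_of M {} = 0"
  using rank_indep[of M "{}"] by (simp add: matroid_def)

lemma indep_iff_rank:
  assumes M: "matroid M" and "X \<subseteq> ground M"
  shows "X \<in> indeps M \<longleftrightarrow> rank_of M X = card X"
proof
  assume r: "rank_of M X = card X"
  obtain I where I: "I \<in> indeps M" "I \<subseteq> X" "card I = rank_of M X"
    using basis_exists[OF M] .
  have "finite X" using assms by (auto simp: matroid_def intro: finite_subset)
  with I r show "X \<in> indeps M" using card_subset_eq by metis
qed (rule rank_indep[OF M])

lemma rank_insert_le:
  assumes M: "matroid M"
  shows "rank_of M (insert e X) \<le> rank_of M X + 1"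
proof -
  obtain I where I: "I \<in> indeps M" "I \<subseteq> {e}" "card I = rank_of M {e}"
    using basis_exists[OF M] .
  have "rank_of M {e} \<le> 1"
    using card_mono[OF _ I(2)] I(3) by simp
  thus ?thesis using rank_submodular[OF M, of "{e}" X] by simp
qed

text \<open>An equation \<open>rank_of M (insert e X) = rank_of M X\<close> stands for membership of
  \<open>e\<close> in the closure of \<open>X\<close> throughout; submodularity carries it to
  supersets.\<close>

lemma rank_insert_superset:
  assumes M: "matroid M" and "rank_of M (insert e X) = rank_of M X" "X \<subseteq> Y"
  shows "rank_of M (insert e Y) = rank_of M Y"
  using rank_submodular_int[OF M, of X Y "insert e X" "insert e Y"] assms
    rank_mono[OF M subset_insertI, of Y e]
  by auto

lemma rank_eq_of_insert:
  assumes M: "matroid M" and "finite Y" "\<And>x. x \<in> Y \<Longrightarrow> rank_of M (insert x X) = rank_of M X"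
  shows "rank_of M (X \<union> Y) = rank_of M X"
  using assms(2,3)
proof (induction Y)
  case (insert y Y)
  have "rank_of M (insert y (X \<union> Y)) = rank_of M (X \<union> Y)"
    by (rule rank_insert_superset[OF M]) (use insert in auto)
  thus ?case using insert by simp
qed simp

lemma insert_indep_iff:
  assumes M: "matroid M" and I: "I \<in> indeps M" and "x \<in> ground M" "x \<notin> I"
  shows "insert x I \<in> indeps M \<longleftrightarrow> rank_of M (insert x I) = rank_of M I + 1"
  using assms indepD[OF M I] by (subst indep_iff_rank) (auto simp: rank_indep)

lemma rank_Un_maximal:
  assumes M: "matroid M" and I: "I \<in> indeps M" and J: "J \<subseteq> ground M"
    and max: "\<And>x. x \<in> J \<Longrightarrow> x \<notin> I \<Longrightarrow> insert x I \<notin> indeps M"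
  shows "rank_of M (I \<union> J) = rank_of M I"
proof (rule rank_eq_of_insert[OF M])
  show "finite J" using M J by (auto simp: matroid_def intro: finite_subset)
  fix x assume x: "x \<in> J"
  show "rank_of M (insert x I) = rank_of M I"
  proof (cases "x \<in> I")
    case False
    hence "rank_of M (insert x I) \<noteq> rank_of M I + 1"
      using insert_indep_iff[OF M I] x J max by blast
    thus ?thesis
      using rank_insert_le[OF M, of x I] rank_mono[OF M subset_insertI, of I x] by linarith
  qed (simp add: insert_absorb)
qed

lemma circuit_rank:
  assumes M: "matroid M" and C: "circuit M (insert p X)" and "p \<notin> X"
  shows "rank_of M (insert p X) = rank_of M X"
proof -
  have X: "X \<in> indeps M" using C assms(3) unfolding circuit_def by blast
  have "rank_of M (insert p X) \<noteq> rank_of M X + 1"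
    using insert_indep_iff[OF M X] C assms(3) unfolding circuit_def by blast
  thus ?thesis
    using rank_insert_le[OF M, of p X] rank_mono[OF M subset_insertI, of X p] by linarith
qed

section \<open>Local connectivity\<close>

lemma local_conn_commute: "local_conn M X Y = local_conn M Y X"
  by (simp add: local_conn_def Un_commute)

lemma local_conn_mono1:
  assumes M: "matroid M" and "X \<subseteq> X'"
  shows "local_conn M X Y \<le> local_conn M X' Y"
proof -
  have "int (rank_of M (X' \<union> Y)) + int (rank_of M X) \<le> int (rank_of M X') + int (rank_of M (X \<union> Y))"
    by (rule rank_submodular_int[OF M]) (use assms(2) in auto)
  thus ?thesis unfolding local_conn_def by simp
qed

lemma local_conn_mono:
  assumes M: "matroid M" and "X \<subseteq> X'" "Y \<subseteq> Y'"
  shows "local_conn M X Y \<le> local_conn M X' Y'"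
  using local_conn_mono1[OF assms(1,2), of Y] local_conn_mono1[OF assms(1,3), of X']
  by (simp add: local_conn_commute)

lemma local_conn_empty: "matroid M \<Longrightarrow> local_conn M {} Y = 0" "matroid M \<Longrightarrow> local_conn M X {} = 0"
  by (simp_all add: local_conn_def rank_empty)

lemma local_conn_nonneg: "matroid M \<Longrightarrow> 0 \<le> local_conn M X Y"
  using local_conn_mono1[of M "{}" X Y] by (simp add: local_conn_empty)

text \<open>By submodularity, the gain in connectivity when \<open>X\<close> grows to
  \<open>X'\<close> is monotone in the second argument, so no gain against \<open>Y'\<close> means
  no gain against \<open>Y\<close>. In terms of the guts: a subset of the same connectivity to the
  other side marks the same point.\<close>

lemma local_conn_stable:
  assumes M: "matroid M" and "X \<subseteq> X'" "Y \<subseteq> Y'" and "local_conn M X Y' = local_conn M X' Y'"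
  shows "local_conn M X Y = local_conn M X' Y"
proof (rule antisym)
  show "local_conn M X' Y \<le> local_conn M X Y"
  proof -
    have "int (rank_of M (X' \<union> Y')) + int (rank_of M (X \<union> Y))
        \<le> int (rank_of M (X' \<union> Y)) + int (rank_of M (X \<union> Y'))"
      by (rule rank_submodular_int[OF M]) (use assms(2,3) in auto)
    thus ?thesis using assms(4) unfolding local_conn_def by simp
  qed
qed (rule local_conn_mono1[OF assms(1,2)])

text \<open>The hypothesis makes each of \<open>e\<close> and \<open>f\<close> raise the rank of
  \<open>X\<close> by exactly one, so the ranks without \<open>Y\<close> cancel and submodularity of
  the ranks with \<open>Y\<close> remains.\<close>

lemma local_conn_insert_insert:
  assumes M: "matroid M"
    and "int (rank_of M (insert e (insert f X))) \<ge> int (rank_of M X) + 2"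
  shows "local_conn M (insert e X) Y + local_conn M (insert f X) Y
           \<le> local_conn M X Y + local_conn M (insert e (insert f X)) Y"
proof -
  have "int (rank_of M (insert e (insert f X) \<union> Y)) + int (rank_of M (X \<union> Y))
      \<le> int (rank_of M (insert e X \<union> Y)) + int (rank_of M (insert f X \<union> Y))"
    by (rule rank_submodular_int[OF M]) auto
  thus ?thesis
    using assms(2) rank_insert_le[OF M, of e X] rank_insert_le[OF M, of f X]
    unfolding local_conn_def by linarith
qed

text \<open>As \<open>p\<close> is in the closure of \<open>Y\<close>, it changes neither the rank
  of \<open>Y\<close> nor that of \<open>X \<union> Y\<close>. The connectivity therefore detects
  whether \<open>p\<close> is in the closure of \<open>X\<close>.\<close>

lemma local_conn_insert_insert_closed:
  assumes M: "matroid M" and "rank_of M (insert p Y) = rank_of M Y"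
  shows "local_conn M (insert p X) (insert p Y)
           = local_conn M X Y + int (rank_of M (insert p X)) - int (rank_of M X)"
  using rank_insert_superset[OF M assms(2), of "X \<union> Y"] assms(2)
  unfolding local_conn_def by simp

lemma contains_strand:
  assumes "finite S" "S \<subseteq> A" "local_conn M S B = 1"
  shows "\<exists>S' \<subseteq> S. strand M A B S'"
  using assms
proof (induction S rule: finite_psubset_induct)
  case (psubset S)
  show ?case
  proof (cases "\<exists>T. T \<subset> S \<and> local_conn M T B = 1")
    case True
    then obtain T where T: "T \<subset> S" "local_conn M T B = 1" by blast
    hence "\<exists>S' \<subseteq> T. strand M A B S'" using psubset.IH[OF T(1)] psubset.prems(1) by blast
    thus ?thesis using T(1) by blast
  next
    case False
    hence "strand M A B S" using psubset.prems by (simp add: strand_def)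
    thus ?thesis by blast
  qed
qed

text \<open>A basis of \<open>S\<close> has the same connectivity to \<open>B\<close> as
  \<open>S\<close> itself, so minimality makes it all of \<open>S\<close>.\<close>

lemma strand_indep:
  assumes M: "matroid M" and S: "strand M A B S" and "S \<subseteq> ground M"
  shows "S \<in> indeps M"
proof -
  obtain I where I: "I \<in> indeps M" "I \<subseteq> S" "card I = rank_of M S"
    using basis_exists[OF M] .
  have r: "rank_of M I = rank_of M S" using I rank_indep[OF M] by simp
  have "int (rank_of M (S \<union> B)) + int (rank_of M I) \<le> int (rank_of M (I \<union> B)) + int (rank_of M S)"
    using I(2) by (intro rank_submodular_int[OF M]) auto
  moreover have "rank_of M (I \<union> B) \<le> rank_of M (S \<union> B)"
    using I(2) by (intro rank_mono[OF M]) auto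
  ultimately have "local_conn M I B = local_conn M S B"
    using r unfolding local_conn_def by simp
  with S I(2) have "I = S" unfolding strand_def by auto
  with I(1) show ?thesis by simp
qed

lemma strand_psubset:
  assumes M: "matroid M" and S: "strand M A B S" and "T \<subset> S"
  shows "local_conn M T B = 0"
proof -
  have "local_conn M S B = 1" "local_conn M T B \<noteq> 1"
    using S assms(3) by (simp_all add: strand_def)
  moreover have "local_conn M T B \<le> local_conn M S B"
    using assms(3) by (intro local_conn_mono1[OF M]) blast
  ultimately show ?thesis using local_conn_nonneg[OF M, of T B] by linarith
qed

text \<open>For a representable matroid this is the dimension of the intersection of the span of \<open>X\<close>
  with the span of \<open>A\<close> and the span of \<open>B\<close>.\<close>

definition guts_rank :: "'a matroid_data \<Rightarrow> 'a set \<Rightarrow> 'a set \<Rightarrow> 'a set \<Rightarrow> int" where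
  "guts_rank M A B X = int (rank_of M X) + int (rank_of M A) + int (rank_of M B)
     - int (rank_of M (X \<union> A)) - int (rank_of M (X \<union> B))"

lemma guts_rank_commute: "guts_rank M A B X = guts_rank M B A X"
  by (simp add: guts_rank_def)

lemma guts_rank_le:
  assumes "matroid M"
  shows "guts_rank M A B X \<le> local_conn M A B"
proof -
  have "int (rank_of M (A \<union> B)) + int (rank_of M X)
      \<le> int (rank_of M (X \<union> A)) + int (rank_of M (X \<union> B))"
    by (rule rank_submodular_int[OF assms]) auto
  thus ?thesis unfolding guts_rank_def local_conn_def by simp
qed

text \<open>Inclusion-exclusion on the guts: what \<open>S\<close> marks plus what \<open>T\<close>
  marks, less what they share.\<close>

lemma guts_rank_eq:
  assumes "X = S \<union> T" "S \<subseteq> A" "T \<subseteq> B"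
  shows "guts_rank M A B X = local_conn M S B + local_conn M T A - local_conn M S T"
proof -
  have "X \<union> A = T \<union> A" "X \<union> B = S \<union> B" using assms by auto
  thus ?thesis unfolding guts_rank_def local_conn_def assms(1) by simp
qed

lemma guts_rank_mono:
  assumes M: "matroid M" and "X \<subseteq> Y" "Y \<subseteq> A \<union> B"
  shows "guts_rank M A B X \<le> guts_rank M A B Y"
proof -
  \<comment> \<open>Passing from \<open>X\<close> to \<open>Y\<close> through \<open>Z\<close> adds
    first elements of \<open>A\<close>, then elements of \<open>B\<close>. In each half one of the
    two subtracted ranks stays fixed, and the other grows no faster than the rank of the set
    itself.\<close>
  define Z where "Z = X \<union> (Y \<inter> A)"
  have "int (rank_of M (Z \<union> B)) + int (rank_of M X) \<le> int (rank_of M Z) + int (rank_of M (X \<union> B))"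
    by (rule rank_submodular_int[OF M]) (auto simp: Z_def)
  moreover have "Z \<union> A = X \<union> A" by (auto simp: Z_def)
  moreover have "int (rank_of M (Y \<union> A)) + int (rank_of M Z) \<le> int (rank_of M Y) + int (rank_of M (Z \<union> A))"
    by (rule rank_submodular_int[OF M]) (use assms in \<open>auto simp: Z_def\<close>)
  moreover have "Z \<union> B = Y \<union> B" using assms by (auto simp: Z_def)
  ultimately show ?thesis unfolding guts_rank_def by simp
qed

text \<open>The argument of \<open>local_conn_insert_insert\<close>, with submodularity applied once
  with \<open>A\<close> and once with \<open>B\<close>.\<close>

lemma guts_rank_insert_insert:
  assumes M: "matroid M"
    and "int (rank_of M (insert e (insert f X))) \<ge> int (rank_of M X) + 2"
  shows "guts_rank M A B (insert e X) + guts_rank M A B (insert f X)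
           \<le> guts_rank M A B X + guts_rank M A B (insert e (insert f X))"
proof -
  have "int (rank_of M (insert e (insert f X) \<union> Y)) + int (rank_of M (X \<union> Y))
      \<le> int (rank_of M (insert e X \<union> Y)) + int (rank_of M (insert f X \<union> Y))" for Y
    by (rule rank_submodular_int[OF M]) auto
  from this[of A] this[of B] show ?thesis
    using assms(2) rank_insert_le[OF M, of e X] rank_insert_le[OF M, of f X]
    unfolding guts_rank_def by linarith
qed

section \<open>Single-element extensions\<close>

lemma extension_indeps:
  assumes "extension_by M p N" "p \<notin> I"
  shows "I \<in> indeps N \<longleftrightarrow> I \<in> indeps M"
proof -
  have "indeps M = {I \<in> indeps N. I \<subseteq> ground N - {p}}" "matroid N"
    using assms(1) by (auto simp: extension_by_def deletion_def)
  thus ?thesis using assms(2) indepD(1)[of N I] by auto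
qed

lemma extension_rank:
  assumes "extension_by M p N" "p \<notin> X"
  shows "rank_of N X = rank_of M X"
proof -
  have "{I \<in> indeps N. I \<subseteq> X} = {I \<in> indeps M. I \<subseteq> X}"
    using extension_indeps[OF assms(1)] assms(2) by blast
  thus ?thesis by (simp add: rank_of_def)
qed

text \<open>The closed sets satisfying \<open>P\<close> form the modular cut of the extension.\<close>

lemma extension_exists:
  assumes M: "matroid M" and p: "p \<notin> ground M"
    and up: "\<And>X Y. X \<subseteq> Y \<Longrightarrow> Y \<subseteq> ground M \<Longrightarrow> P X \<Longrightarrow> P Y"
    and closed: "\<And>X e. insert e X \<subseteq> ground M \<Longrightarrow> rank_of M (insert e X) = rank_of M X
        \<Longrightarrow> P (insert e X) \<Longrightarrow> P X"
    and modular: "\<And>X e f. insert e (insert f X) \<subseteq> ground M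
        \<Longrightarrow> rank_of M (insert e (insert f X)) = rank_of M X + 2
        \<Longrightarrow> P (insert e X) \<Longrightarrow> P (insert f X) \<Longrightarrow> P X"
  shows "extension_by M p \<lparr>ground = insert p (ground M),
           indeps = indeps M \<union> insert p ` {I \<in> indeps M. \<not> P I}\<rparr>"
    (is "extension_by M p ?N")
proof -
  have finE: "finite (ground M)" using M by (simp add: matroid_def)
  have pI: "p \<notin> I" if "I \<in> indeps M" for I using indepD(1)[OF M that] p by auto
  \<comment> \<open>The hypothesis \<open>closed\<close> removes a single spanned element; induction
    on \<open>Y - X\<close> removes them all, each intermediate set having the same rank.\<close>
  have closed': "P X" if "X \<subseteq> Y" "Y \<subseteq> ground M" "rank_of M Y = rank_of M X" "P Y" for X Y
  proof -
    have "finite (Y - X)" using finE that(2) finite_subset by blast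
    hence "P (X \<union> (Y - X)) \<Longrightarrow> X \<union> (Y - X) \<subseteq> ground M
        \<Longrightarrow> rank_of M (X \<union> (Y - X)) = rank_of M X \<Longrightarrow> P X"
    proof (induction "Y - X" arbitrary: X rule: finite_induct)
      case empty
      thus ?case by (metis Un_empty_right)
    next
      case (insert y F)
      have e: "F = Y - insert y X" using insert.hyps by auto
      have u: "X \<union> (Y - X) = insert y X \<union> (Y - insert y X)" using insert.hyps by auto
      have "rank_of M X \<le> rank_of M (insert y X)"
        "rank_of M (insert y X) \<le> rank_of M (X \<union> (Y - X))"
        unfolding u by (auto intro: rank_mono[OF M])
      hence r: "rank_of M (insert y X) = rank_of M X" using insert.prems(3) by simp
      have "P (insert y X)"
        using insert.hyps(3)[OF e] insert.prems r unfolding u by simp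
      moreover have "insert y X \<subseteq> ground M" using insert.prems(2) unfolding u by simp
      ultimately show ?case using closed[OF _ r] by blast
    qed
    moreover have "X \<union> (Y - X) = Y" using that(1) by auto
    ultimately show ?thesis using that by simp
  qed
  \<comment> \<open>The set \<open>I\<close> spans \<open>I \<union> J\<close> by maximality, and
    \<open>J\<close> does too because the cardinalities agree. So \<open>P\<close> moves up from
    either set to the union and back down to the other.\<close>
  have maximal: "P I \<longleftrightarrow> P J" if IJ: "I \<in> indeps M" "J \<in> indeps M" "card I = card J"
    and max: "\<And>x. x \<in> J \<Longrightarrow> x \<notin> I \<Longrightarrow> insert x I \<notin> indeps M" for I J
  proof -
    have sub: "I \<subseteq> ground M" "J \<subseteq> ground M" "I \<union> J \<subseteq> ground M"
      using indepD(1)[OF M] IJ(1,2) by auto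
    have r: "rank_of M (I \<union> J) = rank_of M I" by (rule rank_Un_maximal[OF M IJ(1) sub(2) max])
    have r': "rank_of M (I \<union> J) = rank_of M J"
      unfolding r rank_indep[OF M IJ(1)] rank_indep[OF M IJ(2)] by (rule IJ(3))
    have "P I \<longleftrightarrow> P (I \<union> J)"
      by (rule iffI, rule up[OF Un_upper1 sub(3)], assumption, rule closed'[OF Un_upper1 sub(3) r])
    moreover have "P J \<longleftrightarrow> P (I \<union> J)"
      by (rule iffI, rule up[OF Un_upper2 sub(3)], assumption, rule closed'[OF Un_upper2 sub(3) r'])
    ultimately show ?thesis by simp
  qed
  text \<open>Two one-element extensions of \<open>I\<close> inside \<open>J\<close> cannot both satisfy \<open>P\<close>, by modularity.\<close>
  have step: "\<exists>x\<in>J. x \<notin> I \<and> insert x I \<in> indeps M \<and> \<not> P (insert x I)"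
    if I: "I \<in> indeps M" "\<not> P I" and J: "J \<in> indeps M" "card I < card J"
      and big: "card I + 2 \<le> card J \<or> \<not> P J" for I J
  proof -
    obtain x where x: "x \<in> J" "x \<notin> I" "insert x I \<in> indeps M"
      using augment[OF M I(1) J] by blast
    have cx: "card (insert x I) = card I + 1" using x(2) indepD(2)[OF M I(1)] by simp
    show ?thesis
    proof (cases "\<exists>y\<in>J. y \<notin> insert x I \<and> insert y (insert x I) \<in> indeps M")
      case True
      then obtain y where y: "y \<in> J" "y \<notin> insert x I" "insert y (insert x I) \<in> indeps M" by blast
      have yI: "insert y I \<in> indeps M" by (rule indep_subset[OF M y(3)]) auto
      have "rank_of M (insert y (insert x I)) = rank_of M I + 2"
        using rank_indep[OF M] y I(1) cx indepD(2)[OF M x(3)] by simp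
      hence "\<not> (P (insert y I) \<and> P (insert x I))"
        using modular[of y x I] I(2) indepD(1)[OF M y(3)] by blast
      thus ?thesis using x y yI by blast
    next
      case False
      \<comment> \<open>No element of \<open>J\<close> augments \<open>insert x I\<close>, so the
        two have equal size. This rules out the first alternative of \<open>big\<close>; hence
        \<open>P\<close> fails for \<open>J\<close>, and by \<open>maximal\<close> also for
        \<open>insert x I\<close>.\<close>
      hence "\<not> card (insert x I) < card J"
        using augment[OF M x(3) J(1)] by blast
      hence c: "card J = card (insert x I)" "\<not> P J" using big J(2) cx by auto
      have "\<not> P (insert x I)"
        using maximal[OF x(3) J(1)] False c by metis
      thus ?thesis using x by blast
    qed
  qed
  have "matroid ?N"
    unfolding matroid_def
  proof (intro conjI ballI allI impI)
    show "finite (ground ?N)" using finE by simp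
    show "{} \<in> indeps ?N" using M by (simp add: matroid_def)
    show "I \<subseteq> ground ?N" if "I \<in> indeps ?N" for I
      using that indepD(1)[OF M] by auto
  next
    fix I J assume *: "J \<in> indeps ?N \<and> I \<subseteq> J"
    show "I \<in> indeps ?N"
    proof (cases "J \<in> indeps M")
      case True
      thus ?thesis using * indep_subset[OF M] by auto
    next
      case False
      then obtain K where K: "J = insert p K" "K \<in> indeps M" "\<not> P K" using * by auto
      have sub: "I - {p} \<subseteq> K" using * K(1) by auto
      hence I: "I - {p} \<in> indeps M" using indep_subset[OF M K(2)] by blast
      have "\<not> P (I - {p})" using up[OF sub indepD(1)[OF M K(2)]] K(3) by blast
      hence "insert p (I - {p}) \<in> indeps ?N"
        using imageI[of "I - {p}" "{I \<in> indeps M. \<not> P I}" "insert p"] I by simp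
      thus ?thesis using I by (cases "p \<in> I") (simp_all add: insert_absorb)
    qed
  next
    fix I J assume asm: "I \<in> indeps ?N" "J \<in> indeps ?N" "card I < card J"
    consider (old) "I \<in> indeps M" "J \<in> indeps M"
      | (J) J' where "I \<in> indeps M" "J = insert p J'" "J' \<in> indeps M" "\<not> P J'"
      | (I) I' where "J \<in> indeps M" "I = insert p I'" "I' \<in> indeps M" "\<not> P I'"
      | (IJ) I' J' where "I = insert p I'" "I' \<in> indeps M" "\<not> P I'"
          "J = insert p J'" "J' \<in> indeps M" "\<not> P J'"
      using asm(1,2) by auto
    thus "\<exists>x\<in>J - I. insert x I \<in> indeps ?N"
    proof cases
      case old
      obtain x where "x \<in> J" "x \<notin> I" "insert x I \<in> indeps M"
        by (rule augment[OF M old asm(3)])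
      thus ?thesis by (intro bexI[of _ x]) simp_all
    next
      case J
      show ?thesis
      proof (cases "\<exists>x\<in>J'. x \<notin> I \<and> insert x I \<in> indeps M")
        case True
        then obtain x where "x \<in> J'" "x \<notin> I" "insert x I \<in> indeps M" by blast
        thus ?thesis using J(2) by (intro bexI[of _ x]) simp_all
      next
        \<comment> \<open>Here \<open>I\<close> and \<open>J'\<close> have the same size and the
          same closure, so \<open>P\<close> fails for \<open>I\<close> as well and \<open>p\<close>
          itself is the augmenting element.\<close>
        case False
        have "\<not> card I < card J'" using augment[OF M J(1,3)] False by blast
        moreover have "card J = card J' + 1" using J(2) pI[OF J(3)] indepD(2)[OF M J(3)] by simp
        ultimately have c: "card I = card J'" using asm(3) by simp
        have "\<not> P I" using maximal[OF J(1,3) c] False J(4) by blast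
        hence "insert p I \<in> indeps ?N" using J(1) by simp
        thus ?thesis using J(2) pI[OF J(1)] by (intro bexI[of _ p]) simp_all
      qed
    next
      case I
      \<comment> \<open>Removing \<open>p\<close> from \<open>I\<close> widens the gap to at least
        two, which is the first alternative of \<open>big\<close>.\<close>
      have "card I = card I' + 1" using I(2) pI[OF I(3)] indepD(2)[OF M I(3)] by simp
      hence "\<exists>x\<in>J. x \<notin> I' \<and> insert x I' \<in> indeps M \<and> \<not> P (insert x I')"
        using step[OF I(3,4) I(1)] asm(3) by simp
      then obtain x where x: "x \<in> J" "x \<notin> I'" "insert x I' \<in> indeps M" "\<not> P (insert x I')"
        by blast
      hence "insert p (insert x I') \<in> indeps ?N" by simp
      moreover have "x \<noteq> p" using x(1) pI[OF I(1)] by blast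
      ultimately show ?thesis
        unfolding I(2) using x(1,2) by (intro bexI[of _ x]) (simp_all add: insert_commute)
    next
      case IJ
      \<comment> \<open>Removing \<open>p\<close> from both sides keeps the gap, and
        \<open>P\<close> fails for \<open>J'\<close>: the second alternative of
        \<open>big\<close>.\<close>
      have "card I = card I' + 1" "card J = card J' + 1"
        using IJ pI indepD(2)[OF M] by simp_all
      hence "\<exists>x\<in>J'. x \<notin> I' \<and> insert x I' \<in> indeps M \<and> \<not> P (insert x I')"
        using step[OF IJ(2,3,5)] IJ(6) asm(3) by simp
      then obtain x where x: "x \<in> J'" "x \<notin> I'" "insert x I' \<in> indeps M" "\<not> P (insert x I')"
        by blast
      hence "insert p (insert x I') \<in> indeps ?N" by simp
      moreover have "x \<noteq> p" using x(1) pI[OF IJ(5)] by blast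
      ultimately show ?thesis
        unfolding IJ(1,4) using x(1,2) by (intro bexI[of _ x]) (simp_all add: insert_commute)
    qed
  qed
  moreover have "deletion ?N {p} = M"
    using p indepD(1)[OF M] by (cases M) (auto simp: deletion_def)
  ultimately show ?thesis by (simp add: extension_by_def)
qed

section \<open>Points on the guts\<close>

text \<open>Membership of the future element in the closure of \<open>X\<close>, expressed inside
  \<open>M\<close> alone; \<open>closure_iff\<close> confirms this reading in every extension with
  the two circuits.\<close>

definition spans_point :: "'a matroid_data \<Rightarrow> 'a set \<Rightarrow> 'a set \<Rightarrow> 'a set \<Rightarrow> 'a set \<Rightarrow> 'a set \<Rightarrow> bool" where
  "spans_point M A B A\<^sub>0 B\<^sub>0 X \<longleftrightarrow>
     local_conn M (X \<inter> A) B\<^sub>0 = 1 \<or> local_conn M A\<^sub>0 (X \<inter> B) = 1 \<or> guts_rank M A B X = 2"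

text \<open>Strands are replaced by arbitrary sets of connectivity one to the other side.\<close>

definition consistent :: "'a matroid_data \<Rightarrow> 'a set \<Rightarrow> 'a set \<Rightarrow> 'a set \<Rightarrow> 'a set \<Rightarrow> bool" where
  "consistent M A B A\<^sub>0 B\<^sub>0 \<longleftrightarrow>
     (\<forall>S T. S \<subseteq> A \<longrightarrow> T \<subseteq> B \<longrightarrow> local_conn M S B = 1 \<longrightarrow> local_conn M A T = 1 \<longrightarrow>
        \<not> exactly_two (local_conn M A\<^sub>0 T = 1) (local_conn M S B\<^sub>0 = 1) (local_conn M S T = 1))"

lemma consistentD:
  assumes "consistent M A B A\<^sub>0 B\<^sub>0" "S \<subseteq> A" "T \<subseteq> B" "local_conn M S B = 1" "local_conn M A T = 1"
  shows "\<not> exactly_two (local_conn M A\<^sub>0 T = 1) (local_conn M S B\<^sub>0 = 1) (local_conn M S T = 1)"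
  using assms unfolding consistent_def by simp

lemma consistent_swap:
  assumes "consistent M A B A\<^sub>0 B\<^sub>0"
  shows "consistent M B A B\<^sub>0 A\<^sub>0"
  unfolding consistent_def
proof (intro allI impI)
  fix T S assume *: "T \<subseteq> B" "S \<subseteq> A" "local_conn M T A = 1" "local_conn M B S = 1"
  have "\<not> exactly_two (local_conn M A\<^sub>0 T = 1) (local_conn M S B\<^sub>0 = 1) (local_conn M S T = 1)"
    by (rule consistentD[OF assms *(2,1)]) (use * in \<open>simp_all add: local_conn_commute\<close>)
  thus "\<not> exactly_two (local_conn M B\<^sub>0 S = 1) (local_conn M T A\<^sub>0 = 1) (local_conn M T S = 1)"
    unfolding local_conn_commute[of M B\<^sub>0] local_conn_commute[of M T] by (auto simp: exactly_two_def)
qed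

section \<open>The modular cut of a consistent pair\<close>

locale strand_pair =
  fixes M :: "'a matroid_data" and A B A\<^sub>0 B\<^sub>0 :: "'a set"
  assumes M: "matroid M" and ground: "A \<union> B = ground M" and disjoint: "A \<inter> B = {}"
    and conn_AB: "local_conn M A B = 2"
    and A\<^sub>0: "A\<^sub>0 \<subseteq> A" and conn_A\<^sub>0: "local_conn M A\<^sub>0 B = 1"
    and B\<^sub>0: "B\<^sub>0 \<subseteq> B" and conn_B\<^sub>0: "local_conn M A B\<^sub>0 = 1"
    and conn_A\<^sub>0B\<^sub>0: "local_conn M A\<^sub>0 B\<^sub>0 = 1"
begin

text \<open>The locale assumptions are symmetric in the two sides, so each one-sided argument below
  also serves the other side.\<close>

lemma swap: "strand_pair M B A B\<^sub>0 A\<^sub>0"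
  by unfold_locales
    (use M ground disjoint conn_AB A\<^sub>0 conn_A\<^sub>0 B\<^sub>0 conn_B\<^sub>0 conn_A\<^sub>0B\<^sub>0 in
      \<open>simp_all add: local_conn_commute Un_commute Int_commute\<close>)

lemma spans_point_swap: "spans_point M B A B\<^sub>0 A\<^sub>0 X \<longleftrightarrow> spans_point M A B A\<^sub>0 B\<^sub>0 X"
  unfolding spans_point_def
  by (simp only: guts_rank_commute[of M B A] local_conn_commute[of M B\<^sub>0] local_conn_commute[of M _ A\<^sub>0])
    blast

lemma conn_B\<^sub>0_le: "S \<subseteq> A \<Longrightarrow> local_conn M S B\<^sub>0 \<le> 1"
  using local_conn_mono1[OF M, of S A B\<^sub>0] conn_B\<^sub>0 by simp

lemma conn_A\<^sub>0_le: "T \<subseteq> B \<Longrightarrow> local_conn M A\<^sub>0 T \<le> 1"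
  using local_conn_mono[OF M order_refl, of T B A\<^sub>0] conn_A\<^sub>0 by simp

lemma guts_rank_le_2: "guts_rank M A B X \<le> 2"
  using guts_rank_le[OF M, of A B X] conn_AB by simp

lemma guts_rank_split:
  assumes "X \<subseteq> ground M"
  shows "guts_rank M A B X
    = local_conn M (X \<inter> A) B + local_conn M A (X \<inter> B) - local_conn M (X \<inter> A) (X \<inter> B)"
proof -
  have "X = (X \<inter> A) \<union> (X \<inter> B)" using assms ground by blast
  from guts_rank_eq[OF this Int_lower2 Int_lower2] show ?thesis
    by (simp only: local_conn_commute[of M _ A])
qed

lemma conn_parts_le:
  "local_conn M (X \<inter> A) (X \<inter> B) \<le> local_conn M (X \<inter> A) B"
  "local_conn M (X \<inter> A) (X \<inter> B) \<le> local_conn M A (X \<inter> B)"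
  by (rule local_conn_mono[OF M]; blast)+

text \<open>The values 1, 1 and 2 in \<open>spans_point\<close> are upper bounds of the three
  quantities, so failing to attain them means being smaller.\<close>

lemma not_spans_point:
  assumes "\<not> spans_point M A B A\<^sub>0 B\<^sub>0 X"
  shows "local_conn M (X \<inter> A) B\<^sub>0 = 0" "local_conn M A\<^sub>0 (X \<inter> B) = 0" "guts_rank M A B X \<le> 1"
  using assms conn_B\<^sub>0_le[of "X \<inter> A"] conn_A\<^sub>0_le[of "X \<inter> B"] guts_rank_le_2[of X]
    local_conn_nonneg[OF M, of "X \<inter> A" B\<^sub>0] local_conn_nonneg[OF M, of A\<^sub>0 "X \<inter> B"]
  unfolding spans_point_def by auto

lemma spans_point_mono:
  assumes XY: "X \<subseteq> Y" "Y \<subseteq> ground M" and "spans_point M A B A\<^sub>0 B\<^sub>0 X"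
  shows "spans_point M A B A\<^sub>0 B\<^sub>0 Y"
proof -
  have "local_conn M (X \<inter> A) B\<^sub>0 \<le> local_conn M (Y \<inter> A) B\<^sub>0"
    "local_conn M A\<^sub>0 (X \<inter> B) \<le> local_conn M A\<^sub>0 (Y \<inter> B)"
    using XY(1) by (auto intro!: local_conn_mono[OF M])
  moreover have "guts_rank M A B X \<le> guts_rank M A B Y"
    using guts_rank_mono[OF M XY(1)] XY(2) ground by simp
  ultimately show ?thesis
    using assms(3) not_spans_point[of Y] unfolding spans_point_def[of M A B A\<^sub>0 B\<^sub>0 X] by linarith
qed

text \<open>Since \<open>f\<close> is in \<open>A\<close> and the guts rank is unchanged, only the
  clause about \<open>B\<^sub>0\<close> can become true. Then \<open>insert f S\<close> marks the
  wanted point, and the unchanged guts rank means that this point was already marked by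
  \<open>S\<close> or by \<open>T\<close>.\<close>

lemma spans_point_guts_insert_left:
  assumes cons: "consistent M A B A\<^sub>0 B\<^sub>0" and X: "X \<subseteq> ground M" and f: "f \<in> A"
    and guts: "guts_rank M A B (insert f X) = guts_rank M A B X"
    and spans: "spans_point M A B A\<^sub>0 B\<^sub>0 (insert f X)"
  shows "spans_point M A B A\<^sub>0 B\<^sub>0 X"
proof (rule ccontr)
  assume "\<not> ?thesis"
  note not = not_spans_point[OF this]
  define S where "S = X \<inter> A"
  define T where "T = X \<inter> B"
  have parts: "insert f X \<inter> A = insert f S" "insert f X \<inter> B = T"
    using f disjoint by (auto simp: S_def T_def)
  have sub: "insert f S \<subseteq> A" "T \<subseteq> B" using f by (auto simp: S_def T_def)
  have fX: "insert f X \<subseteq> ground M" using X f ground by blast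
  have one: "local_conn M (insert f S) B\<^sub>0 = 1"
    using spans not guts unfolding spans_point_def parts T_def by simp
  have g': "guts_rank M A B (insert f X)
      = local_conn M (insert f S) B + local_conn M A T - local_conn M (insert f S) T"
    using guts_rank_split[OF fX] unfolding parts .
  have g: "guts_rank M A B X = local_conn M S B + local_conn M A T - local_conn M S T"
    using guts_rank_split[OF X] unfolding S_def T_def .
  have le: "local_conn M (insert f S) T \<le> local_conn M A T"
    by (rule local_conn_mono1[OF M sub(1)])
  have "local_conn M (insert f S) B\<^sub>0 \<le> local_conn M (insert f S) B"
    by (rule local_conn_mono[OF M order_refl B\<^sub>0])
  \<comment> \<open>The guts rank is at most 1, yet by \<open>le\<close> at least the connectivity
    of \<open>insert f S\<close> to \<open>B\<close>, which is at least 1; equality holds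
    throughout.\<close>
  with one g' le not(3) guts
  have a': "local_conn M (insert f S) B = 1" "local_conn M A T = local_conn M (insert f S) T"
    by linarith+
  \<comment> \<open>Otherwise \<open>S\<close> would mark the same point as
    \<open>insert f S\<close>, contrary to \<open>not(1)\<close>.\<close>
  have "local_conn M S B \<noteq> 1"
  proof
    assume "local_conn M S B = 1"
    hence "local_conn M S B\<^sub>0 = local_conn M (insert f S) B\<^sub>0"
      using a'(1) by (intro local_conn_stable[OF M _ B\<^sub>0]) auto
    thus False using one not(1) S_def by simp
  qed
  moreover have "local_conn M S B \<le> local_conn M (insert f S) B"
    by (rule local_conn_mono1[OF M]) blast
  moreover have "local_conn M S T \<le> local_conn M S B"
    by (rule local_conn_mono[OF M order_refl sub(2)])
  ultimately have "local_conn M S B = 0" "local_conn M S T = 0"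
    using a'(1) local_conn_nonneg[OF M, of S T] by linarith+
  \<comment> \<open>So \<open>S\<close> marks nothing and \<open>T\<close> carries the whole guts
    rank of \<open>X\<close>. It marks the same point as \<open>insert f S\<close>, and consistency
    relates it to \<open>A\<^sub>0\<close>.\<close>
  hence "local_conn M A T = 1" using g g' a' guts by linarith
  thus False
    using consistentD[OF cons sub a'(1)] a'(2) one not(2) by (simp add: exactly_two_def T_def)
qed

lemma spans_point_guts_insert:
  assumes cons: "consistent M A B A\<^sub>0 B\<^sub>0" and X: "insert f X \<subseteq> ground M"
    and guts: "guts_rank M A B (insert f X) = guts_rank M A B X"
    and spans: "spans_point M A B A\<^sub>0 B\<^sub>0 (insert f X)"
  shows "spans_point M A B A\<^sub>0 B\<^sub>0 X"
proof (cases "f \<in> A")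
  case True
  thus ?thesis using spans_point_guts_insert_left[OF cons _ True guts spans] X by blast
next
  case False
  hence fB: "f \<in> B" and X': "X \<subseteq> ground M" using X ground by blast+
  have "spans_point M B A B\<^sub>0 A\<^sub>0 X"
    by (rule strand_pair.spans_point_guts_insert_left[OF swap consistent_swap[OF cons] X' fB])
      (simp_all only: spans_point_swap spans guts_rank_commute[of M B A] guts)
  thus ?thesis unfolding spans_point_swap .
qed

text \<open>An element in the closure of \<open>X\<close> changes none of the ranks in the guts
  rank, so the previous lemma applies.\<close>

lemma spans_point_closed:
  assumes cons: "consistent M A B A\<^sub>0 B\<^sub>0" and X: "insert f X \<subseteq> ground M"
    and r: "rank_of M (insert f X) = rank_of M X"
    and spans: "spans_point M A B A\<^sub>0 B\<^sub>0 (insert f X)"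
  shows "spans_point M A B A\<^sub>0 B\<^sub>0 X"
proof (rule spans_point_guts_insert[OF cons X _ spans])
  have "rank_of M (insert f X \<union> Y) = rank_of M (X \<union> Y)" for Y
    using rank_insert_superset[OF M r, of "X \<union> Y"] by simp
  thus "guts_rank M A B (insert f X) = guts_rank M A B X"
    unfolding guts_rank_def r by simp
qed

lemma guts_rank_0:
  assumes "X \<subseteq> ground M" "guts_rank M A B X \<le> 0"
  shows "local_conn M (X \<inter> A) B = 0" "local_conn M A (X \<inter> B) = 0"
  using guts_rank_split[OF assms(1)] conn_parts_le[of X] assms(2)
    local_conn_nonneg[OF M, of "X \<inter> A" B] local_conn_nonneg[OF M, of A "X \<inter> B"]
  by linarith+

lemma guts_rank_nonneg: "X \<subseteq> ground M \<Longrightarrow> 0 \<le> guts_rank M A B X"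
  using guts_rank_split[of X] conn_parts_le[of X] local_conn_nonneg[OF M, of "X \<inter> A" B]
  by linarith

text \<open>Each of \<open>e\<close> and \<open>f\<close> must raise the guts rank of
  \<open>X\<close>, and the two increases add up by \<open>guts_rank_insert_insert\<close>. As the
  guts rank lies between 0 and 2, all four values are forced.\<close>

lemma modular_guts:
  assumes cons: "consistent M A B A\<^sub>0 B\<^sub>0" and sub: "insert e (insert f X) \<subseteq> ground M"
    and r: "rank_of M (insert e (insert f X)) = rank_of M X + 2"
    and e: "spans_point M A B A\<^sub>0 B\<^sub>0 (insert e X)" and f: "spans_point M A B A\<^sub>0 B\<^sub>0 (insert f X)"
    and not: "\<not> spans_point M A B A\<^sub>0 B\<^sub>0 X"
  shows "guts_rank M A B X = 0" "guts_rank M A B (insert e X) = 1"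
    "guts_rank M A B (insert f X) = 1" "guts_rank M A B (insert e (insert f X)) = 2"
proof -
  have eX: "insert e X \<subseteq> ground M" and fX: "insert f X \<subseteq> ground M" and X: "X \<subseteq> ground M"
    using sub by auto
  have "guts_rank M A B (insert e X) \<noteq> guts_rank M A B X"
    using spans_point_guts_insert[OF cons eX _ e] not by blast
  moreover have "guts_rank M A B (insert f X) \<noteq> guts_rank M A B X"
    using spans_point_guts_insert[OF cons fX _ f] not by blast
  moreover have "guts_rank M A B X \<le> guts_rank M A B (insert e X)"
    "guts_rank M A B X \<le> guts_rank M A B (insert f X)"
    using eX fX ground by (auto intro!: guts_rank_mono[OF M])
  moreover have "guts_rank M A B (insert e X) + guts_rank M A B (insert f X)
      \<le> guts_rank M A B X + guts_rank M A B (insert e (insert f X))"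
    by (rule guts_rank_insert_insert[OF M]) (simp add: r)
  ultimately show "guts_rank M A B X = 0" "guts_rank M A B (insert e X) = 1"
    "guts_rank M A B (insert f X) = 1" "guts_rank M A B (insert e (insert f X)) = 2"
    using guts_rank_nonneg[OF X] guts_rank_le_2[of "insert e (insert f X)"] by linarith+
qed

text \<open>Both \<open>insert e S\<close> and \<open>insert f S\<close> would have connectivity 1
  to \<open>B\<^sub>0\<close> while \<open>S\<close> has 0. Together they would have at least 2, but
  no subset of \<open>A\<close> exceeds 1.\<close>

lemma spans_point_modular_same:
  assumes cons: "consistent M A B A\<^sub>0 B\<^sub>0" and sub: "insert e (insert f X) \<subseteq> ground M"
    and r: "rank_of M (insert e (insert f X)) = rank_of M X + 2"
    and e: "spans_point M A B A\<^sub>0 B\<^sub>0 (insert e X)" and f: "spans_point M A B A\<^sub>0 B\<^sub>0 (insert f X)"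
    and A: "e \<in> A" "f \<in> A"
  shows "spans_point M A B A\<^sub>0 B\<^sub>0 X"
proof (rule ccontr)
  assume no: "\<not> ?thesis"
  note not = not_spans_point[OF no]
  note g = modular_guts[OF cons sub r e f no]
  define S where "S = X \<inter> A"
  have int_A: "insert e X \<inter> A = insert e S" "insert f X \<inter> A = insert f S"
    and int_B: "insert e X \<inter> B = X \<inter> B" "insert f X \<inter> B = X \<inter> B"
    using A disjoint by (auto simp: S_def)
  have one: "local_conn M (insert e S) B\<^sub>0 = 1" "local_conn M (insert f S) B\<^sub>0 = 1"
    using e f not(2) g unfolding spans_point_def int_A int_B by simp_all
  \<comment> \<open>The rank jump of two over \<open>X\<close> persists over its subset
    \<open>S\<close>.\<close>
  have "int (rank_of M (insert e (insert f X))) + int (rank_of M S)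
      \<le> int (rank_of M (insert e (insert f S))) + int (rank_of M X)"
    by (rule rank_submodular_int[OF M]) (auto simp: S_def)
  hence "int (rank_of M S) + 2 \<le> int (rank_of M (insert e (insert f S)))" using r by simp
  from local_conn_insert_insert[OF M this, of B\<^sub>0]
  have "1 + 1 \<le> local_conn M S B\<^sub>0 + local_conn M (insert e (insert f S)) B\<^sub>0"
    unfolding one .
  moreover have "local_conn M (insert e (insert f S)) B\<^sub>0 \<le> 1"
    by (rule conn_B\<^sub>0_le) (use A in \<open>auto simp: S_def\<close>)
  ultimately show False using not(1) S_def by simp
qed

text \<open>The forced guts ranks say that \<open>insert e S\<close> and \<open>insert f T\<close>
  mark one point each and that these points differ, although both agree with the point of
  \<open>A\<^sub>0\<close> and \<open>B\<^sub>0\<close>; consistency forbids this.\<close>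

lemma spans_point_modular_different:
  assumes cons: "consistent M A B A\<^sub>0 B\<^sub>0" and sub: "insert e (insert f X) \<subseteq> ground M"
    and r: "rank_of M (insert e (insert f X)) = rank_of M X + 2"
    and e: "spans_point M A B A\<^sub>0 B\<^sub>0 (insert e X)" and f: "spans_point M A B A\<^sub>0 B\<^sub>0 (insert f X)"
    and AB: "e \<in> A" "f \<in> B"
  shows "spans_point M A B A\<^sub>0 B\<^sub>0 X"
proof (rule ccontr)
  assume no: "\<not> ?thesis"
  note not = not_spans_point[OF no]
  note g = modular_guts[OF cons sub r e f no]
  define S where "S = X \<inter> A"
  define T where "T = X \<inter> B"
  have parts: "insert e X \<inter> A = insert e S" "insert f X \<inter> A = S"
      "insert e X \<inter> B = T" "insert f X \<inter> B = insert f T"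
      "insert e (insert f X) \<inter> A = insert e S" "insert e (insert f X) \<inter> B = insert f T"
    using AB disjoint by (auto simp: S_def T_def)
  have one: "local_conn M (insert e S) B\<^sub>0 = 1" "local_conn M A\<^sub>0 (insert f T) = 1"
    using e f not(1,2) g unfolding spans_point_def parts by (simp_all add: S_def T_def)
  have eX: "insert e X \<subseteq> ground M" and fX: "insert f X \<subseteq> ground M" and X: "X \<subseteq> ground M"
    using sub by auto
  have zero: "local_conn M S B = 0" "local_conn M A T = 0"
    using guts_rank_0[OF X] g(1) by (simp_all add: S_def T_def)
  have sub': "insert e S \<subseteq> A" "insert f T \<subseteq> B" using AB by (auto simp: S_def T_def)
  have "local_conn M (insert e S) T \<le> local_conn M A T"
    by (rule local_conn_mono1[OF M sub'(1)])
  hence a: "local_conn M (insert e S) B = 1"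
    using guts_rank_split[OF eX] g(2) zero local_conn_nonneg[OF M, of "insert e S" T]
    unfolding parts by linarith
  have "local_conn M S (insert f T) \<le> local_conn M S B"
    by (rule local_conn_mono[OF M order_refl sub'(2)])
  hence b: "local_conn M A (insert f T) = 1"
    using guts_rank_split[OF fX] g(3) zero local_conn_nonneg[OF M, of S "insert f T"]
    unfolding parts by linarith
  have "local_conn M (insert e S) (insert f T) = 0"
    using guts_rank_split[OF sub] g(4) a b unfolding parts by linarith
  thus False
    using consistentD[OF cons sub' a b] one by (simp add: exactly_two_def)
qed

lemma spans_point_modular:
  assumes cons: "consistent M A B A\<^sub>0 B\<^sub>0" and sub: "insert e (insert f X) \<subseteq> ground M"
    and r: "rank_of M (insert e (insert f X)) = rank_of M X + 2"
    and e: "spans_point M A B A\<^sub>0 B\<^sub>0 (insert e X)" and f: "spans_point M A B A\<^sub>0 B\<^sub>0 (insert f X)"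
  shows "spans_point M A B A\<^sub>0 B\<^sub>0 X"
proof -
  consider (AA) "e \<in> A" "f \<in> A" | (AB) "e \<in> A" "f \<in> B" | (BA) "e \<in> B" "f \<in> A"
    | (BB) "e \<in> B" "f \<in> B"
    using sub ground by blast
  thus ?thesis
  proof cases
    case AA
    thus ?thesis by (rule spans_point_modular_same[OF assms])
  next
    case AB
    thus ?thesis by (rule spans_point_modular_different[OF assms])
  next
    case BA
    show ?thesis
      by (rule spans_point_modular_different[OF cons _ _ f e BA(2,1)])
        (use sub r in \<open>simp_all add: insert_commute\<close>)
  next
    case BB
    have "spans_point M B A B\<^sub>0 A\<^sub>0 X"
      by (rule strand_pair.spans_point_modular_same[OF swap consistent_swap[OF cons] sub r _ _ BB])
        (simp_all only: spans_point_swap e f)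
    thus ?thesis unfolding spans_point_swap .
  qed
qed

definition point_extension :: "'a \<Rightarrow> 'a matroid_data" where
  "point_extension p = \<lparr>ground = insert p (ground M),
     indeps = indeps M \<union> insert p ` {I \<in> indeps M. \<not> spans_point M A B A\<^sub>0 B\<^sub>0 I}\<rparr>"

lemma point_extension_by:
  assumes "p \<notin> ground M" and cons: "consistent M A B A\<^sub>0 B\<^sub>0"
  shows "extension_by M p (point_extension p)"
  unfolding point_extension_def
  by (rule extension_exists[OF M assms(1) spans_point_mono spans_point_closed[OF cons]
        spans_point_modular[OF cons]])

lemma point_extension_swap: "strand_pair.point_extension M B A B\<^sub>0 A\<^sub>0 p = point_extension p"
  unfolding strand_pair.point_extension_def[OF swap] point_extension_def spans_point_swap ..

text \<open>The set \<open>A\<^sub>0\<close> spans the point through its connectivity to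
  \<open>B\<^sub>0\<close>. A proper subset of a strand has connectivity 0 to \<open>B\<close>, so
  every clause of \<open>spans_point\<close> fails for it.\<close>

lemma point_extension_circuit:
  assumes p: "p \<notin> ground M" and strand: "strand M A B A\<^sub>0"
  shows "circuit (point_extension p) (insert p A\<^sub>0)"
  unfolding circuit_def
proof (intro conjI allI impI)
  have A\<^sub>0_ground: "A\<^sub>0 \<subseteq> ground M" using A\<^sub>0 ground by blast
  show "insert p A\<^sub>0 \<subseteq> ground (point_extension p)"
    using A\<^sub>0_ground by (auto simp: point_extension_def)
  have pA\<^sub>0: "p \<notin> A\<^sub>0" using A\<^sub>0_ground p by blast
  have indep: "A\<^sub>0 \<in> indeps M" by (rule strand_indep[OF M strand A\<^sub>0_ground])
  have spans: "spans_point M A B A\<^sub>0 B\<^sub>0 A\<^sub>0"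
    unfolding spans_point_def Int_absorb2[OF A\<^sub>0] using conn_A\<^sub>0B\<^sub>0 by simp
  show "insert p A\<^sub>0 \<notin> indeps (point_extension p)"
  proof
    assume "insert p A\<^sub>0 \<in> indeps (point_extension p)"
    moreover have "insert p A\<^sub>0 \<notin> indeps M" using indepD(1)[OF M] p by blast
    ultimately obtain I where I: "insert p A\<^sub>0 = insert p I" "I \<in> indeps M"
      "\<not> spans_point M A B A\<^sub>0 B\<^sub>0 I"
      unfolding point_extension_def by auto
    have "p \<notin> I" using indepD(1)[OF M I(2)] p by blast
    hence "I = A\<^sub>0" using I(1) pA\<^sub>0 by (simp add: insert_ident)
    thus False using I(3) spans by simp
  qed
  fix D assume D: "D \<subset> insert p A\<^sub>0"
  have sub: "D - {p} \<subseteq> A\<^sub>0" using D by blast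
  have D': "D - {p} \<in> indeps M" by (rule indep_subset[OF M indep sub])
  show "D \<in> indeps (point_extension p)"
  proof (cases "p \<in> D")
    case False
    thus ?thesis using D' by (simp add: point_extension_def)
  next
    case True
    hence ps: "D - {p} \<subset> A\<^sub>0" using D pA\<^sub>0 by blast
    have "D - {p} \<subseteq> ground M" using sub A\<^sub>0_ground by blast
    note guts = guts_rank_split[OF this]
    have parts: "(D - {p}) \<inter> A = D - {p}" "(D - {p}) \<inter> B = {}"
      using sub A\<^sub>0 disjoint by blast+
    have zero: "local_conn M (D - {p}) B = 0" by (rule strand_psubset[OF M strand ps])
    have "local_conn M (D - {p}) B\<^sub>0 \<le> 0"
      using local_conn_mono[OF M order_refl B\<^sub>0, of "D - {p}"] zero by simp
    moreover have "guts_rank M A B (D - {p}) = 0"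
      using guts zero unfolding parts by (simp add: local_conn_empty[OF M])
    ultimately have "\<not> spans_point M A B A\<^sub>0 B\<^sub>0 (D - {p})"
      unfolding spans_point_def parts by (simp add: local_conn_empty[OF M])
    hence "insert p (D - {p}) \<in> indeps (point_extension p)"
      using D' imageI[of "D - {p}" "{I \<in> indeps M. \<not> spans_point M A B A\<^sub>0 B\<^sub>0 I}" "insert p"]
      by (simp add: point_extension_def)
    thus ?thesis using True by (simp add: insert_absorb)
  qed
qed

end

section \<open>Extensions in which both strands close to circuits\<close>

locale extended_strand_pair = strand_pair +
  fixes p :: 'a and N :: "'a matroid_data"
  assumes p: "p \<notin> ground M" and ext: "extension_by M p N"
    and circuit_A\<^sub>0: "circuit N (insert p A\<^sub>0)" and circuit_B\<^sub>0: "circuit N (insert p B\<^sub>0)"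
begin

lemma swap_extended: "extended_strand_pair M B A B\<^sub>0 A\<^sub>0 p N"
  by (intro extended_strand_pair.intro swap extended_strand_pair_axioms.intro
      p ext circuit_A\<^sub>0 circuit_B\<^sub>0)

lemma N: "matroid N"
  using ext by (simp add: extension_by_def)

lemma p_notin: "X \<subseteq> ground M \<Longrightarrow> p \<notin> X"
  using p by blast

lemma rank_N: "X \<subseteq> ground M \<Longrightarrow> rank_of N X = rank_of M X"
  by (rule extension_rank[OF ext p_notin])

lemma A_ground: "A \<subseteq> ground M"
  using ground by blast

lemma B_ground: "B \<subseteq> ground M"
  using ground by blast

lemma conn_N:
  assumes "X \<subseteq> ground M" "Y \<subseteq> ground M"
  shows "local_conn N X Y = local_conn M X Y"
  unfolding local_conn_def using assms by (simp add: rank_N)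

lemma closure_A\<^sub>0: "rank_of N (insert p A\<^sub>0) = rank_of N A\<^sub>0"
  by (rule circuit_rank[OF N circuit_A\<^sub>0 p_notin]) (use A\<^sub>0 A_ground in blast)

lemma closure_A: "rank_of N (insert p A) = rank_of N A"
  by (rule rank_insert_superset[OF N closure_A\<^sub>0 A\<^sub>0])

lemma closure_B\<^sub>0: "rank_of N (insert p B\<^sub>0) = rank_of N B\<^sub>0"
  by (rule circuit_rank[OF N circuit_B\<^sub>0 p_notin]) (use B\<^sub>0 B_ground in blast)

lemma closure_B: "rank_of N (insert p B) = rank_of N B"
  by (rule rank_insert_superset[OF N closure_B\<^sub>0 B\<^sub>0])

lemma nonloop: "rank_of N {p} = 1"
proof -
  have "A\<^sub>0 \<noteq> {}" using conn_A\<^sub>0 local_conn_empty[OF M] by auto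
  moreover have "p \<notin> A\<^sub>0" using A\<^sub>0 A_ground p by blast
  ultimately have "{p} \<subset> insert p A\<^sub>0" by blast
  hence "{p} \<in> indeps N" using circuit_A\<^sub>0 by (simp add: circuit_def)
  thus ?thesis using rank_indep[OF N] by simp
qed

lemma conn_common_point: "1 \<le> local_conn N (insert p X) (insert p Y)"
proof -
  have "local_conn N {p} {p} \<le> local_conn N (insert p X) (insert p Y)"
    by (rule local_conn_mono[OF N]) auto
  moreover have "local_conn N {p} {p} = 1" by (simp add: local_conn_def nonloop)
  ultimately show ?thesis by simp
qed

lemma rank_insert_p: "rank_of N X \<le> rank_of N (insert p X)" "rank_of N (insert p X) \<le> rank_of N X + 1"
  by (rule rank_mono[OF N subset_insertI], rule rank_insert_le[OF N])

text \<open>Adding \<open>p\<close> to \<open>S\<close> and to \<open>B\<^sub>0\<close> raises their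
  connectivity by the rank jump of \<open>p\<close> over \<open>S\<close>. The result is exactly 1:
  at least 1 because \<open>p\<close> is a common nonloop, at most 1 by comparison with
  \<open>A\<close>, whose closure contains \<open>p\<close>.\<close>

lemma closure_left:
  assumes S: "S \<subseteq> A"
  shows "rank_of N (insert p S) = rank_of N S \<longleftrightarrow> local_conn M S B\<^sub>0 = 1"
proof -
  have eq: "local_conn N (insert p X) (insert p B\<^sub>0)
      = local_conn M X B\<^sub>0 + int (rank_of N (insert p X)) - int (rank_of N X)" if "X \<subseteq> A" for X
    using local_conn_insert_insert_closed[OF N closure_B\<^sub>0, of X] conn_N[of X B\<^sub>0] that B\<^sub>0
      A_ground B_ground by auto
  have "local_conn N (insert p S) (insert p B\<^sub>0) \<le> local_conn N (insert p A) (insert p B\<^sub>0)"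
    using S by (intro local_conn_mono1[OF N]) blast
  also have "\<dots> = 1" using eq[OF order_refl] conn_B\<^sub>0 closure_A by simp
  finally have "local_conn N (insert p S) (insert p B\<^sub>0) \<le> 1" .
  thus ?thesis
    using eq[OF S] conn_common_point[of S B\<^sub>0] conn_B\<^sub>0_le[OF S] rank_insert_p(1)[of S] by linarith
qed

lemma closure_right:
  assumes "T \<subseteq> B"
  shows "rank_of N (insert p T) = rank_of N T \<longleftrightarrow> local_conn M A\<^sub>0 T = 1"
  using extended_strand_pair.closure_left[OF swap_extended assms]
  by (simp only: local_conn_commute[of M _ A\<^sub>0])

lemma conn_insert_left:
  assumes "S \<subseteq> A"
  shows "local_conn N (insert p S) (insert p B)
    = local_conn M S B + int (rank_of N (insert p S)) - int (rank_of N S)"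
proof -
  have "S \<subseteq> ground M" using assms A_ground by blast
  thus ?thesis
    using local_conn_insert_insert_closed[OF N closure_B, of S] conn_N[OF _ B_ground] by simp
qed

lemma conn_insert_le:
  assumes S: "S \<subseteq> A" and T: "T \<subseteq> B"
  shows "local_conn N (insert p S) (insert p T)
    \<le> local_conn M S B + int (rank_of N (insert p S)) - int (rank_of N S)"
  using local_conn_mono[OF N order_refl insert_mono[OF T], of "insert p S" p]
    conn_insert_left[OF S] by simp

text \<open>This determines the closures containing \<open>p\<close> from \<open>M\<close> alone and
  is the core of uniqueness.\<close>

lemma closure_iff:
  assumes X: "X \<subseteq> ground M"
  shows "rank_of N (insert p X) = rank_of N X \<longleftrightarrow> spans_point M A B A\<^sub>0 B\<^sub>0 X"
proof
  have AB: "X \<inter> A \<subseteq> A" "X \<inter> B \<subseteq> B" by auto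
  assume spans: "spans_point M A B A\<^sub>0 B\<^sub>0 X"
  show "rank_of N (insert p X) = rank_of N X"
  proof (cases "guts_rank M A B X = 2")
    case False
    with spans consider "local_conn M (X \<inter> A) B\<^sub>0 = 1" | "local_conn M A\<^sub>0 (X \<inter> B) = 1"
      unfolding spans_point_def by blast
    thus ?thesis
    proof cases
      case 1
      thus ?thesis
        using rank_insert_superset[OF N _ Int_lower1] closure_left[OF AB(1)] by blast
    next
      case 2
      thus ?thesis
        using rank_insert_superset[OF N _ Int_lower1] closure_right[OF AB(2)] by blast
    qed
  next
    \<comment> \<open>As \<open>p\<close> is in the closures of \<open>A\<close> and
      \<open>B\<close>, a rank jump over \<open>X\<close> would lift the guts rank to 3, above the
      connectivity of \<open>A\<close> and \<open>B\<close>.\<close>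
    case True
    have "rank_of N (insert p X \<union> A) = rank_of N (X \<union> A)"
      using rank_insert_superset[OF N closure_A, of "X \<union> A"] by simp
    moreover have "rank_of N (insert p X \<union> B) = rank_of N (X \<union> B)"
      using rank_insert_superset[OF N closure_B, of "X \<union> B"] by simp
    moreover have "guts_rank N A B X = guts_rank M A B X"
      unfolding guts_rank_def using X A_ground B_ground by (simp add: rank_N)
    moreover have "guts_rank N A B (insert p X) \<le> 2"
      using guts_rank_le[OF N, of A B "insert p X"] conn_N[OF A_ground B_ground] conn_AB by simp
    ultimately show ?thesis
      using True rank_insert_p(1)[of X] unfolding guts_rank_def[of N] by linarith
  qed
next
  have AB: "X \<inter> A \<subseteq> A" "X \<inter> B \<subseteq> B" by auto
  assume closed: "rank_of N (insert p X) = rank_of N X"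
  show "spans_point M A B A\<^sub>0 B\<^sub>0 X"
  proof (rule ccontr)
    assume no: "\<not> ?thesis"
    note not = not_spans_point[OF this]
    have "rank_of N (insert p (X \<inter> A)) \<noteq> rank_of N (X \<inter> A)"
      "rank_of N (insert p (X \<inter> B)) \<noteq> rank_of N (X \<inter> B)"
      using closure_left[OF AB(1)] closure_right[OF AB(2)] not by simp_all
    hence jump: "rank_of N (insert p (X \<inter> A)) = rank_of N (X \<inter> A) + 1"
      "rank_of N (insert p (X \<inter> B)) = rank_of N (X \<inter> B) + 1"
      using rank_insert_p[of "X \<inter> A"] rank_insert_p[of "X \<inter> B"] by linarith+
    have "insert p (X \<inter> A) \<union> insert p (X \<inter> B) = insert p X" "(X \<inter> A) \<union> (X \<inter> B) = X"
      using X ground by blast+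
    \<comment> \<open>The rank jumps on both parts but not on their union. With
      \<open>conn_insert_le\<close> on each side, the increase by two makes the guts rank of
      \<open>X\<close> at least 2.\<close>
    hence "local_conn N (insert p (X \<inter> A)) (insert p (X \<inter> B)) = local_conn N (X \<inter> A) (X \<inter> B) + 2"
      unfolding local_conn_def using closed jump by simp
    also have "local_conn N (X \<inter> A) (X \<inter> B) = local_conn M (X \<inter> A) (X \<inter> B)"
      by (rule conn_N) (use X in auto)
    finally have eq: "local_conn N (insert p (X \<inter> A)) (insert p (X \<inter> B))
      = local_conn M (X \<inter> A) (X \<inter> B) + 2" .
    have "local_conn M (X \<inter> A) (X \<inter> B) + 1 \<le> local_conn M (X \<inter> A) B"
      using conn_insert_le[OF AB] eq jump by simp
    moreover have "local_conn M (X \<inter> A) (X \<inter> B) + 1 \<le> local_conn M A (X \<inter> B)"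
      using extended_strand_pair.conn_insert_le[OF swap_extended AB(2,1)] eq jump
      by (simp add: local_conn_commute[of N "insert p (X \<inter> B)"] local_conn_commute[of M _ A])
    ultimately show False
      using guts_rank_split[OF X] not(3) local_conn_nonneg[OF M, of "X \<inter> A" "X \<inter> B"] by linarith
  qed
qed

text \<open>The three conditions say that \<open>p\<close> is in the closure of \<open>T\<close>,
  that \<open>p\<close> is in the closure of \<open>S\<close>, and that \<open>S\<close> and
  \<open>T\<close> mark the same point. Any two of these imply the third.\<close>

lemma consistent: "consistent M A B A\<^sub>0 B\<^sub>0"
  unfolding consistent_def
proof (intro allI impI)
  fix S T assume S: "S \<subseteq> A" and T: "T \<subseteq> B"
    and conn: "local_conn M S B = 1" "local_conn M A T = 1"
  have ground: "S \<subseteq> ground M" "T \<subseteq> ground M" using S T A_ground B_ground by auto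
  have both: "local_conn M S T = 1"
    if "rank_of N (insert p S) = rank_of N S" "rank_of N (insert p T) = rank_of N T"
  proof -
    have "1 \<le> local_conn M S T"
      using conn_common_point[of S T] local_conn_insert_insert_closed[OF N that(2), of S] that(1)
        conn_N[OF ground] by simp
    moreover have "local_conn M S T \<le> 1"
      using local_conn_mono[OF M order_refl T, of S] conn(1) by simp
    ultimately show ?thesis by simp
  qed
  \<comment> \<open>With \<open>p\<close> added to both sets, the connectivity is 1 plus the rank
    jump of \<open>p\<close> over \<open>T\<close>, yet it is bounded by the connectivity of
    \<open>S\<close> to \<open>B\<close>, which is 1.\<close>
  have right: "rank_of N (insert p T) = rank_of N T"
    if "local_conn M S T = 1" "rank_of N (insert p S) = rank_of N S"
    using conn_insert_le[OF S T] local_conn_insert_insert_closed[OF N that(2), of T]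
      that conn conn_N[OF ground(2,1)] rank_insert_p(1)[of T]
    by (simp add: local_conn_commute[of N "insert p T"] local_conn_commute[of M T])
  have left: "rank_of N (insert p S) = rank_of N S"
    if "local_conn M S T = 1" "rank_of N (insert p T) = rank_of N T"
    using extended_strand_pair.conn_insert_le[OF swap_extended T S]
      local_conn_insert_insert_closed[OF N that(2), of S]
      that conn conn_N[OF ground] rank_insert_p(1)[of S]
    by (simp add: local_conn_commute[of N "insert p T"] local_conn_commute[of M T])
  show "\<not> exactly_two (local_conn M A\<^sub>0 T = 1) (local_conn M S B\<^sub>0 = 1) (local_conn M S T = 1)"
    unfolding exactly_two_def closure_left[OF S, symmetric] closure_right[OF T, symmetric]
    using both left right by blast
qed

text \<open>Independent sets avoiding \<open>p\<close> come from \<open>M\<close>; for the others,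
  \<open>closure_iff\<close> decides when \<open>p\<close> can be added to an independent set of
  \<open>M\<close>.\<close>

lemma extension_unique: "N = point_extension p"
proof -
  have gN: "ground N = insert p (ground M)" using ext by (simp add: extension_by_def)
  have "I \<in> indeps N \<longleftrightarrow> I \<in> indeps (point_extension p)" for I
  proof (cases "p \<in> I")
    case False
    thus ?thesis using extension_indeps[OF ext False] by (auto simp: point_extension_def)
  next
    case True
    then obtain J where J: "I = insert p J" "p \<notin> J" by (meson mk_disjoint_insert)
    have JN: "J \<in> indeps N \<longleftrightarrow> J \<in> indeps M" by (rule extension_indeps[OF ext J(2)])
    have J_new: "I \<in> indeps (point_extension p) \<longleftrightarrow> J \<in> indeps M \<and> \<not> spans_point M A B A\<^sub>0 B\<^sub>0 J"
    proof
      assume "I \<in> indeps (point_extension p)"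
      moreover have "I \<notin> indeps M" using True indepD(1)[OF M] p by blast
      ultimately obtain K where K: "I = insert p K" "K \<in> indeps M" "\<not> spans_point M A B A\<^sub>0 B\<^sub>0 K"
        unfolding point_extension_def by auto
      have "p \<notin> K" using indepD(1)[OF M K(2)] p by blast
      hence "K = J" using K(1) J by (simp add: insert_ident)
      thus "J \<in> indeps M \<and> \<not> spans_point M A B A\<^sub>0 B\<^sub>0 J" using K by simp
    qed (simp add: J point_extension_def)
    have "I \<in> indeps N \<longleftrightarrow> J \<in> indeps M \<and> \<not> spans_point M A B A\<^sub>0 B\<^sub>0 J"
    proof (cases "J \<in> indeps M")
      case False
      moreover have "I \<in> indeps N \<Longrightarrow> J \<in> indeps N"
        using indep_subset[OF N, of I J] J by blast
      ultimately show ?thesis using JN by blast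
    next
      case True
      hence JN': "J \<in> indeps N" using JN by simp
      have "p \<in> ground N" using gN by simp
      hence "I \<in> indeps N \<longleftrightarrow> rank_of N (insert p J) = rank_of N J + 1"
        unfolding J(1) by (rule insert_indep_iff[OF N JN' _ J(2)])
      also have "\<dots> \<longleftrightarrow> rank_of N (insert p J) \<noteq> rank_of N J"
        using rank_insert_p[of J] by linarith
      finally show ?thesis using closure_iff[OF indepD(1)[OF M True]] True by simp
    qed
    thus ?thesis using J_new by simp
  qed
  hence "indeps N = indeps (point_extension p)" by blast
  moreover have "ground N = ground (point_extension p)" using gN by (simp add: point_extension_def)
  ultimately show ?thesis by (cases N, cases "point_extension p") simp
qed

end

text \<open>A violating pair \<open>S\<close>, \<open>T\<close> contains strands, and by
  \<open>local_conn_stable\<close> these have the same connectivities as \<open>S\<close> and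
  \<open>T\<close> to all subsets of the other side, so they violate the condition too.\<close>

lemma (in strand_pair) consistent_iff_strands:
  "consistent M A B A\<^sub>0 B\<^sub>0 \<longleftrightarrow>
     \<not> (\<exists>A\<^sub>1 B\<^sub>1. strand M A B A\<^sub>1 \<and> strand M B A B\<^sub>1 \<and> A\<^sub>1 \<noteq> A\<^sub>0 \<and> B\<^sub>1 \<noteq> B\<^sub>0 \<and>
          exactly_two (local_conn M A\<^sub>0 B\<^sub>1 = 1) (local_conn M A\<^sub>1 B\<^sub>0 = 1) (local_conn M A\<^sub>1 B\<^sub>1 = 1))"
    (is "_ \<longleftrightarrow> \<not> ?bad")
proof
  assume cons: "consistent M A B A\<^sub>0 B\<^sub>0"
  show "\<not> ?bad"
  proof
    assume ?bad
    then obtain A\<^sub>1 B\<^sub>1 where "strand M A B A\<^sub>1" "strand M B A B\<^sub>1"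
      and two: "exactly_two (local_conn M A\<^sub>0 B\<^sub>1 = 1) (local_conn M A\<^sub>1 B\<^sub>0 = 1) (local_conn M A\<^sub>1 B\<^sub>1 = 1)"
      by (elim exE conjE)
    hence "A\<^sub>1 \<subseteq> A" "B\<^sub>1 \<subseteq> B" "local_conn M A\<^sub>1 B = 1" "local_conn M A B\<^sub>1 = 1"
      by (simp_all add: strand_def local_conn_commute[of M A])
    from consistentD[OF cons this] two show False by simp
  qed
next
  assume no: "\<not> ?bad"
  show "consistent M A B A\<^sub>0 B\<^sub>0"
    unfolding consistent_def
  proof (intro allI impI notI)
    fix S T assume S: "S \<subseteq> A" and T: "T \<subseteq> B"
      and conn: "local_conn M S B = 1" "local_conn M A T = 1"
      and two: "exactly_two (local_conn M A\<^sub>0 T = 1) (local_conn M S B\<^sub>0 = 1) (local_conn M S T = 1)"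
    have "finite (ground M)" using M by (simp add: matroid_def)
    hence fin: "finite S" "finite T" using S T ground by (auto intro: finite_subset)
    obtain A\<^sub>1 where A\<^sub>1: "A\<^sub>1 \<subseteq> S" "strand M A B A\<^sub>1"
      using contains_strand[OF fin(1) S conn(1)] by blast
    have "local_conn M T A = 1" using conn(2) by (simp add: local_conn_commute)
    then obtain B\<^sub>1 where B\<^sub>1: "B\<^sub>1 \<subseteq> T" "strand M B A B\<^sub>1"
      using contains_strand[OF fin(2) T] by blast
    have sA: "local_conn M A\<^sub>1 Y = local_conn M S Y" if "Y \<subseteq> B" for Y
      using A\<^sub>1(2) conn(1) by (intro local_conn_stable[OF M A\<^sub>1(1) that]) (simp add: strand_def)
    have sB: "local_conn M X B\<^sub>1 = local_conn M X T" if "X \<subseteq> A" for X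
      unfolding local_conn_commute[of M X] using B\<^sub>1(2) \<open>local_conn M T A = 1\<close>
      by (intro local_conn_stable[OF M B\<^sub>1(1) that]) (simp add: strand_def)
    have "B\<^sub>1 \<subseteq> B" "A\<^sub>0 \<subseteq> A" using B\<^sub>1(1) T A\<^sub>0 by auto
    hence "local_conn M A\<^sub>0 B\<^sub>1 = local_conn M A\<^sub>0 T" "local_conn M A\<^sub>1 B\<^sub>0 = local_conn M S B\<^sub>0"
      "local_conn M A\<^sub>1 B\<^sub>1 = local_conn M S T"
      using sA[OF B\<^sub>0] sB[OF A\<^sub>0] sA[of B\<^sub>1] sB[OF S] by simp_all
    with two have two': "exactly_two (local_conn M A\<^sub>0 B\<^sub>1 = 1) (local_conn M A\<^sub>1 B\<^sub>0 = 1)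
        (local_conn M A\<^sub>1 B\<^sub>1 = 1)" by simp
    \<comment> \<open>If one of the new strands were the old one, one of the three conditions would
      hold and the other two would be equivalent, so one or three would hold but never exactly
      two.\<close>
    moreover have "A\<^sub>1 \<noteq> A\<^sub>0" "B\<^sub>1 \<noteq> B\<^sub>0"
      using two' conn_A\<^sub>0B\<^sub>0 by (auto simp: exactly_two_def)
    ultimately show False using no A\<^sub>1(2) B\<^sub>1(2) by blast
  qed
qed

theorem theorem1p1:
  fixes M :: "'a matroid_data" and A B A\<^sub>0 B\<^sub>0 :: "'a set" and p :: 'a
  assumes "matroid M"
    and "exact_3_separation M A B"
    and "strand M A B A\<^sub>0"
    and "strand M B A B\<^sub>0"
    and "local_conn M A\<^sub>0 B\<^sub>0 = 1"
    and "p \<notin> ground M"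
  shows "((\<exists>M'. extension_by M p M' \<and> circuit M' (insert p A\<^sub>0) \<and> circuit M' (insert p B\<^sub>0))
           \<longleftrightarrow>
          \<not> (\<exists>A\<^sub>1 B\<^sub>1. strand M A B A\<^sub>1 \<and> strand M B A B\<^sub>1 \<and> A\<^sub>1 \<noteq> A\<^sub>0 \<and> B\<^sub>1 \<noteq> B\<^sub>0 \<and>
               exactly_two (local_conn M A\<^sub>0 B\<^sub>1 = 1)
                           (local_conn M A\<^sub>1 B\<^sub>0 = 1)
                           (local_conn M A\<^sub>1 B\<^sub>1 = 1)))
         \<and>
         ((\<exists>M'. extension_by M p M' \<and> circuit M' (insert p A\<^sub>0) \<and> circuit M' (insert p B\<^sub>0))
           \<longrightarrow>
          (\<exists>!M'. extension_by M p M' \<and> circuit M' (insert p A\<^sub>0) \<and> circuit M' (insert p B\<^sub>0)))"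
proof -
  interpret strand_pair M A B A\<^sub>0 B\<^sub>0
    by unfold_locales
      (use assms in \<open>simp_all add: exact_3_separation_def strand_def local_conn_def Un_commute\<close>)
  let ?ext = "\<lambda>N. extension_by M p N \<and> circuit N (insert p A\<^sub>0) \<and> circuit N (insert p B\<^sub>0)"
  have extended: "extended_strand_pair M A B A\<^sub>0 B\<^sub>0 p N" if "?ext N" for N
    using that assms(6) by unfold_locales simp_all
  \<comment> \<open>Every admissible extension equals one concrete matroid, so existence reduces to
    consistency and uniqueness is immediate.\<close>
  have unique: "N = point_extension p" if "?ext N" for N
    by (rule extended_strand_pair.extension_unique[OF extended[OF that]])
  have "consistent M A B A\<^sub>0 B\<^sub>0" if "?ext N" for N
    by (rule extended_strand_pair.consistent[OF extended[OF that]])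
  moreover have "?ext (point_extension p)" if "consistent M A B A\<^sub>0 B\<^sub>0"
  proof (intro conjI)
    show "extension_by M p (point_extension p)" by (rule point_extension_by[OF assms(6) that])
    show "circuit (point_extension p) (insert p A\<^sub>0)"
      by (rule point_extension_circuit[OF assms(6,3)])
    show "circuit (point_extension p) (insert p B\<^sub>0)"
      using strand_pair.point_extension_circuit[OF swap assms(6,4)]
      unfolding point_extension_swap .
  qed
  ultimately have "(\<exists>N. ?ext N) \<longleftrightarrow> consistent M A B A\<^sub>0 B\<^sub>0" by blast
  moreover have "\<exists>!N. ?ext N" if "\<exists>N. ?ext N"
    using that unique by blast
  ultimately show ?thesis unfolding consistent_iff_strands by blast
qed

end
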